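(* Let $d\geqslant 1$ and $k\in\mathbb N_0$ be integers, let $\Omega\subset\mathbb R^d$ be a bounded open polyhedral set, $\mathcal T$ a conforming simplicial mesh of $\Omega$, and $\mathbb E$ a finite-dimensional real vector space with $m=\dim\mathbb E\geqslant1$, identified with $\mathbb R^m$ through a fixed basis. Let $M=\binom{d+k}{d}$. Then $\mathrm{NN}_d^m(k;2H_{\mathcal T},MN_{\mathcal S})$ realizes $\mathcal V_k(\mathcal T;\mathbb E)$ pointwise on $\overline\Omega$, including all skeleton values: every $\boldsymbol v\in\mathcal V_k(\mathcal T;\mathbb E)$ agrees at every point of $\overline\Omega$ with some member of $\mathrm{NN}_d^m(k;2H_{\mathcal T},MN_{\mathcal S})$. Moreover, $MN_{\mathcal S}\leqslant M(2^{d+1}-1)N_{\mathcal T}$.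
   Context: Mesh. $\Omega\subset\mathbb R^d$ is a bounded open polyhedral set, not necessarily convex or connected. A conforming simplicial mesh $\mathcal T=\{\tau_1,\dots,\tau_{N_{\mathcal T}}\}$ of $\Omega$ is a finite collection of pairwise disjoint open $d$-simplices $\tau_i\subset\Omega$ (elements) with $\bigcup_{\tau\in\mathcal T}\overline\tau=\overline\Omega$ such that for $i\neq j$ the set $\overline\tau_i\cap\overline\tau_j$ is either empty or a common subsimplex (face) of both. $N_{\mathcal T}$ is the number of elements. The skeleton is $\bigcup_{\tau\in\mathcal T}\partial\tau$. $H_{\mathcal T}$ is the number of distinct unoriented affine hyperplanes supporting the $(d-1)$-dimensional facets of elements (coplanar facets contribute only once). $\mathcal S_{\mathcal T}$ is the collection of all distinct relatively open nonempty subsimplices of the mesh (of all dimensions $0,\dots,d$, including the open elements and the vertices), and $N_{\mathcal S}=|\mathcal S_{\mathcal T}|$. Function space. $\mathcal V_k(\mathcal T;\mathbb E)$ is the space of $\boldsymbol v\in C(\overline\Omega;\mathbb E)$ such that for every $\tau\in\mathcal T$, $\boldsymbol v|_\tau$ is an $\mathbb E$-valued polynomial of total degree at most $k$. Networks. $\varrho_0(t)=\mathbf 1_{\{t>0\}}$ and $\varrho_j(t)=(\max\{t,0\})^j$ for $j\geqslant1$, applied componentwise to vectors. For positive integers $d,m,n_1,n_2$ and $k\in\mathbb N_0$, $\mathrm{NN}_d^m(k;n_1,n_2)$ is the class of functions $\mathbb R^d\to\mathbb R^m$ of the form $$\boldsymbol x\mapsto\boldsymbol W_{\mathrm{III}}\,\varrho_k\big(\boldsymbol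 W_{\mathrm{II},0}\varrho_0(\boldsymbol W_{\mathrm I}\boldsymbol x+\boldsymbol b_{\mathrm I})+\boldsymbol W_{\mathrm{II},1}\varrho_1(\boldsymbol W_{\mathrm I}\boldsymbol x+\boldsymbol b_{\mathrm I})+\boldsymbol b_{\mathrm{II}}\big)$$ with $\boldsymbol W_{\mathrm I}\in\mathbb R^{n_1\times d}$, $\boldsymbol b_{\mathrm I}\in\mathbb R^{n_1}$, $\boldsymbol W_{\mathrm{II},0},\boldsymbol W_{\mathrm{II},1}\in\mathbb R^{n_2\times n_1}$, $\boldsymbol b_{\mathrm{II}}\in\mathbb R^{n_2}$, $\boldsymbol W_{\mathrm{III}}\in\mathbb R^{m\times n_2}$. *)

theory Defs
  imports "HOL-Analysis.Analysis"
begin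

text \<open>Closure description: the set need be neither convex nor connected, and slits are allowed.\<close>

definition open_polyhedral :: "'a::euclidean_space set \<Rightarrow> bool" where
  "open_polyhedral \<Omega> \<longleftrightarrow> open \<Omega> \<and> bounded \<Omega> \<and>
     (\<exists>\<P>. finite \<P> \<and> (\<forall>P\<in>\<P>. polytope P) \<and> closure \<Omega> = \<Union>\<P>)"

definition open_simplex :: "'a::euclidean_space set \<Rightarrow> bool" where
  "open_simplex \<tau> \<longleftrightarrow> (\<exists>S. int DIM('a) simplex S \<and> \<tau> = interior S)"

definition conforming_mesh :: "'a::euclidean_space set \<Rightarrow> 'a set set \<Rightarrow> bool" where
  "conforming_mesh \<Omega> \<T> \<longleftrightarrow>
     finite \<T> \<and> (\<forall>\<tau>\<in>\<T>. open_simplex \<tau> \<and> \<tau> \<subseteq> \<Omega>) \<and> disjoint \<T> \<and>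
     (\<Union>\<tau>\<in>\<T>. closure \<tau>) = closure \<Omega> \<and>
     (\<forall>\<sigma>\<in>\<T>. \<forall>\<tau>\<in>\<T>. \<sigma> \<noteq> \<tau> \<longrightarrow>
        closure \<sigma> \<inter> closure \<tau> = {} \<or>
        (closure \<sigma> \<inter> closure \<tau>) face_of closure \<sigma> \<and>
        (closure \<sigma> \<inter> closure \<tau>) face_of closure \<tau>)"

definition facet_hyperplanes :: "'a::euclidean_space set set \<Rightarrow> 'a set set" where
  "facet_hyperplanes \<T> = {affine hull F |F \<tau>. \<tau> \<in> \<T> \<and> F facet_of closure \<tau>}"

definition subsimplices :: "'a::euclidean_space set set \<Rightarrow> 'a set set" where
  "subsimplices \<T> = {rel_interior F |F \<tau>. \<tau> \<in> \<T> \<and> F face_of closure \<tau> \<and> F \<noteq> {}}"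

definition multi_indices :: "nat \<Rightarrow> ('n::finite \<Rightarrow> nat) set" where
  "multi_indices k = {\<alpha>. (\<Sum>i\<in>UNIV. \<alpha> i) \<le> k}"

lemma finite_multi_indices [simp]: "finite (multi_indices k :: ('n::finite \<Rightarrow> nat) set)"
proof (rule finite_subset)
  show "multi_indices k \<subseteq> {\<alpha> :: 'n \<Rightarrow> nat. \<forall>i. \<alpha> i \<le> k}"
  proof
    fix \<alpha> :: "'n \<Rightarrow> nat"
    assume "\<alpha> \<in> multi_indices k"
    then have le: "(\<Sum>i\<in>UNIV. \<alpha> i) \<le> k"
      by (simp add: multi_indices_def)
    have "\<alpha> i \<le> k" for i
    proof -
      have "\<alpha> i \<le> (\<Sum>i\<in>UNIV. \<alpha> i)"
        by (rule member_le_sum) simp_all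
      with le show ?thesis by linarith
    qed
    then show "\<alpha> \<in> {\<alpha>. \<forall>i. \<alpha> i \<le> k}" by simp
  qed
  have "finite (Pi\<^sub>E (UNIV :: 'n set) (\<lambda>_. {..k}))"
    by (rule finite_PiE) simp_all
  moreover have "{\<alpha> :: 'n \<Rightarrow> nat. \<forall>i. \<alpha> i \<le> k} = Pi\<^sub>E UNIV (\<lambda>_. {..k})"
    by (auto simp: PiE_UNIV_domain)
  ultimately show "finite {\<alpha> :: 'n \<Rightarrow> nat. \<forall>i. \<alpha> i \<le> k}" by simp
qed

definition vec_polynomial :: "nat \<Rightarrow> (real ^ 'n \<Rightarrow> 'e::real_vector) \<Rightarrow> bool" where
  "vec_polynomial k p \<longleftrightarrow>
     (\<exists>c. \<forall>x. p x = (\<Sum>\<alpha>\<in>multi_indices k. (\<Prod>i\<in>UNIV. (x $ i) ^ \<alpha> i) *\<^sub>R c \<alpha>))"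

text \<open>Members are total functions; only their values on the closure of \<open>\<Omega>\<close> are constrained.\<close>

definition mesh_space ::
    "nat \<Rightarrow> (real ^ 'n) set \<Rightarrow> (real ^ 'n) set set \<Rightarrow> (real ^ 'n \<Rightarrow> 'e::real_normed_vector) set" where
  "mesh_space k \<Omega> \<T> =
     {v. continuous_on (closure \<Omega>) v \<and>
         (\<forall>\<tau>\<in>\<T>. \<exists>p. vec_polynomial k p \<and> (\<forall>x\<in>\<tau>. v x = p x))}"

text \<open>The case \<open>j = 0\<close> is separate because \<open>(max t 0) ^ 0 = 1\<close> also for \<open>t \<le> 0\<close>.\<close>

definition activation :: "nat \<Rightarrow> real \<Rightarrow> real" where
  "activation j t = (if j = 0 then (if t > 0 then 1 else 0) else (max t 0) ^ j)"

text \<open>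
  The widths vary with the mesh, so hidden neurons are numbered by natural numbers: only the
  weights with indices below \<open>n1\<close> and \<open>n2\<close> are used.
\<close>

definition NN :: "nat \<Rightarrow> nat \<Rightarrow> nat \<Rightarrow> (real ^ 'n \<Rightarrow> real ^ 'm) set" where
  "NN k n1 n2 =
     {f. \<exists>(W1 :: nat \<Rightarrow> 'n \<Rightarrow> real) (b1 :: nat \<Rightarrow> real)
          (W20 :: nat \<Rightarrow> nat \<Rightarrow> real) (W21 :: nat \<Rightarrow> nat \<Rightarrow> real) (b2 :: nat \<Rightarrow> real)
          (W3 :: 'm \<Rightarrow> nat \<Rightarrow> real).
        \<forall>x. let z = (\<lambda>j. (\<Sum>i\<in>UNIV. W1 j i * x $ i) + b1 j) in
          f x = (\<chi> l. \<Sum>q<n2. W3 l q *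
            activation k ((\<Sum>j<n1. W20 q j * activation 0 (z j)) +
                          (\<Sum>j<n1. W21 q j * activation 1 (z j)) + b2 q))}"

end

theory Submission
  imports Defs
begin

text \<open>
  A continuous piecewise polynomial is determined by one polynomial of degree at most $k$ on each
  relatively open subsimplex, and these subsimplices partition the closure of the domain
  (\<open>subsimplices_cover\<close>, \<open>subsimplices_disjoint\<close>,
  \<open>mesh_space_polynomial_on_subsimplex\<close>). It therefore suffices to produce, for each
  subsimplex $S$, functions that vanish off $S$ and whose restrictions to $S$ span the polynomials.
  
  The first layer evaluates the equation of every facet hyperplane with both signs. For a simplex, these
  equations are up to scaling its barycentric coordinates, and a face is cut out by the sign pattern
  positive on its vertices and zero on the others (\<open>rel_interior_face_barycentric\<close>). Heaviside
  values detect signs exactly, so the number $m_S$ of violated sign conditions is $0$ on $S$ and at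
  least $1$ off $S$, with no transition zone. ReLU values recover the barycentric coordinates themselves,
  and thereby every affine function (\<open>two_sided_simplex\<close>). Hence a second-layer neuron
  $\varrho_k(\ell - 2 m_S)$, with $\ell$ affine and $0 < \ell \le 2$ on the closure of the domain, equals
  $\ell^k$ on $S$ and $0$ off $S$. This also covers $k = 0$.
  
  It remains to find $\binom{d+k}{d}$ such forms whose $k$-th powers span the polynomials of degree at
  most $k$. The forms $1 + \epsilon\,\alpha \cdot x$ with $\alpha$ in the principal lattice do so for
  every $\epsilon \ne 0$ (\<open>monomial_in_span_affine_powers\<close>), and a small $\epsilon$ ensures the
  bounds. The estimate for the width holds because each $d$-simplex has $2^{d+1} - 1$ nonempty faces.
\<close>

section \<open>Powers of affine forms spanning the polynomials\<close>

text \<open>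
  These are the weights of the divided difference at the nodes $0, \dots, g$, which annihilates
  lower degrees and is normalized on the monomial of degree $g$. The induction uses that the
  difference of two shifted copies of a divided difference is a multiple of the next one.
\<close>

lemma ex_divided_difference_weights:
  "\<exists>w :: nat \<Rightarrow> real. (\<forall>j>g. w j = 0) \<and> (\<forall>b<g. (\<Sum>j\<le>g. w j * real j ^ b) = 0)
     \<and> (\<Sum>j\<le>g. w j * real j ^ g) = 1"
proof (induction g)
  case 0
  show ?case by (rule exI[of _ "\<lambda>j. if j = 0 then 1 else 0"]) simp
next
  case (Suc g)
  then obtain w :: "nat \<Rightarrow> real" where w0: "\<And>j. j > g \<Longrightarrow> w j = 0"
    and wlt: "\<And>b. b < g \<Longrightarrow> (\<Sum>j\<le>g. w j * real j ^ b) = 0"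
    and weq: "(\<Sum>j\<le>g. w j * real j ^ g) = 1" by blast
  \<comment> \<open>The weights of \<open>f \<mapsto> (L (f (\<cdot> + 1)) - L f) / (g + 1)\<close>, where \<open>L\<close> has the weights \<open>w\<close>;
    the factor \<open>g + 1 = (g + 1) choose g\<close> restores the normalization.\<close>
  define w' where "w' j = ((if j = 0 then 0 else w (j - 1)) - w j) / (real g + 1)" for j
  have moment: "(\<Sum>j\<le>Suc g. w' j * real j ^ b)
      = (\<Sum>i<b. real (b choose i) * (\<Sum>j\<le>g. w j * real j ^ i)) / (real g + 1)" for b
  proof -
    have shift: "(\<Sum>j\<le>Suc g. (if j = 0 then 0 else w (j - 1)) * real j ^ b)
        = (\<Sum>j\<le>g. w j * (real j + 1) ^ b)"
      by (subst sum.atMost_Suc_shift) (simp add: add.commute)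
    have binom: "(real j + 1) ^ b - real j ^ b = (\<Sum>i<b. real (b choose i) * real j ^ i)" for j
      by (simp add: binomial_ring lessThan_Suc_atMost[symmetric])
    have "(\<Sum>j\<le>Suc g. w' j * real j ^ b)
        = ((\<Sum>j\<le>Suc g. (if j = 0 then 0 else w (j - 1)) * real j ^ b)
            - (\<Sum>j\<le>Suc g. w j * real j ^ b)) / (real g + 1)"
      unfolding w'_def sum_subtractf[symmetric] sum_divide_distrib
      by (intro sum.cong refl) (simp add: field_simps)
    also have "\<dots> = (\<Sum>j\<le>g. w j * ((real j + 1) ^ b - real j ^ b)) / (real g + 1)"
      unfolding shift by (simp add: w0 right_diff_distrib sum_subtractf)
    also have "(\<Sum>j\<le>g. w j * ((real j + 1) ^ b - real j ^ b))
        = (\<Sum>i<b. real (b choose i) * (\<Sum>j\<le>g. w j * real j ^ i))"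
      unfolding binom sum_distrib_left
      by (subst sum.swap) (intro sum.cong refl, simp add: mult_ac)
    finally show ?thesis .
  qed
  show ?case
  proof (intro exI[of _ w'] conjI allI impI)
    show "w' j = 0" if "j > Suc g" for j
      using that by (simp add: w'_def w0)
    show "(\<Sum>j\<le>Suc g. w' j * real j ^ b) = 0" if "b < Suc g" for b
      unfolding moment using that wlt by simp
    show "(\<Sum>j\<le>Suc g. w' j * real j ^ Suc g) = 1"
      unfolding moment by (simp add: wlt weq)
  qed
qed

text \<open>
  The multinomial theorem for a sum with one summand equal to \<open>1\<close>. Of the coefficients
  only the sign matters later: none of them vanishes, so a power of an affine form contains every
  monomial of the admissible degrees.
\<close>

lemma ex_multinomial_coefficients:
  "\<exists>m :: ('n::finite \<Rightarrow> nat) \<Rightarrow> real. (\<forall>\<beta>\<in>multi_indices k. m \<beta> > 0) \<and>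
     (\<forall>y. (1 + (\<Sum>i\<in>UNIV. y i)) ^ k = (\<Sum>\<beta>\<in>multi_indices k. m \<beta> * (\<Prod>i\<in>UNIV. y i ^ \<beta> i)))"
proof (induction k)
  case 0
  have "multi_indices 0 = {\<lambda>_ :: 'n. 0 :: nat}"
    by (auto simp: multi_indices_def)
  then show ?case by (intro exI[of _ "\<lambda>_. 1"]) simp
next
  case (Suc k)
  then obtain m :: "('n \<Rightarrow> nat) \<Rightarrow> real" where pos: "\<And>\<beta>. \<beta> \<in> multi_indices k \<Longrightarrow> m \<beta> > 0"
    and exp: "\<And>y. (1 + (\<Sum>i\<in>UNIV. y i)) ^ k
        = (\<Sum>\<beta>\<in>multi_indices k. m \<beta> * (\<Prod>i\<in>UNIV. y i ^ \<beta> i))" by blast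
  \<comment> \<open>Multiplying by \<open>y i\<close> shifts the exponent \<open>i\<close> up by one; \<open>s i\<close> is the shifted coefficient family.\<close>
  define s where "s i \<gamma> = (if \<gamma> i > 0 then m (\<gamma>(i := \<gamma> i - 1)) else 0)" for i :: 'n and \<gamma> :: "'n \<Rightarrow> nat"
  define t where "t \<gamma> = (if \<gamma> \<in> multi_indices k then m \<gamma> else 0)" for \<gamma> :: "'n \<Rightarrow> nat"
  have sum_upd: "(\<Sum>l\<in>UNIV. (\<gamma>(i := c)) l) = c + (\<Sum>l\<in>UNIV - {i}. \<gamma> l)" 
    for \<gamma> :: "'n \<Rightarrow> nat" and i c
    by (subst sum.remove[of _ i]) auto
  have sum_rem: "(\<Sum>l\<in>UNIV. \<gamma> l) = \<gamma> i + (\<Sum>l\<in>UNIV - {i}. \<gamma> l)" 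
    for \<gamma> :: "'n \<Rightarrow> nat" and i
    by (subst sum.remove[of _ i]) auto
  have lower: "\<gamma>(i := \<gamma> i - 1) \<in> multi_indices k"
    if "\<gamma> \<in> multi_indices (Suc k)" "\<gamma> i > 0" for \<gamma> :: "'n \<Rightarrow> nat" and i
    using that sum_rem[of \<gamma> i] unfolding multi_indices_def mem_Collect_eq sum_upd by linarith
  have raise: "\<beta>(i := Suc (\<beta> i)) \<in> multi_indices (Suc k)"
    if "\<beta> \<in> multi_indices k" for \<beta> :: "'n \<Rightarrow> nat" and i
    using that sum_rem[of \<beta> i] unfolding multi_indices_def mem_Collect_eq sum_upd by linarith
  have s_nonneg: "s i \<gamma> \<ge> 0" if "\<gamma> \<in> multi_indices (Suc k)" for i \<gamma>
    using lower[OF that] pos unfolding s_def by (auto intro: less_imp_le)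
  have pos': "t \<gamma> + (\<Sum>i\<in>UNIV. s i \<gamma>) > 0" if \<gamma>: "\<gamma> \<in> multi_indices (Suc k)" for \<gamma>
  proof (cases "\<gamma> \<in> multi_indices k")
    case True
    then show ?thesis
      using pos s_nonneg[OF \<gamma>] by (auto simp: t_def intro!: add_pos_nonneg sum_nonneg)
  next
    case False
    then have "(\<Sum>i\<in>UNIV. \<gamma> i) \<noteq> 0"
      unfolding multi_indices_def mem_Collect_eq by linarith
    then obtain i where "\<gamma> i > 0" by (meson gr0I sum.neutral)
    then have "s i \<gamma> > 0" using lower[OF \<gamma>] pos by (simp add: s_def)
    then have "(\<Sum>i\<in>UNIV. s i \<gamma>) > 0"
      using s_nonneg[OF \<gamma>] by (intro sum_pos2[of _ i]) auto
    then show ?thesis by (simp add: t_def False)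
  qed
  have mono_sub: "multi_indices k \<subseteq> (multi_indices (Suc k) :: ('n \<Rightarrow> nat) set)"
    by (auto simp: multi_indices_def)
  have "(1 + (\<Sum>i\<in>UNIV. y i)) ^ Suc k
      = (\<Sum>\<gamma>\<in>multi_indices (Suc k). (t \<gamma> + (\<Sum>i\<in>UNIV. s i \<gamma>)) * (\<Prod>l\<in>UNIV. y l ^ \<gamma> l))" for y
  proof -
    have step: "y i * (\<Sum>\<beta>\<in>multi_indices k. m \<beta> * (\<Prod>l\<in>UNIV. y l ^ \<beta> l))
        = (\<Sum>\<gamma>\<in>multi_indices (Suc k). s i \<gamma> * (\<Prod>l\<in>UNIV. y l ^ \<gamma> l))" for i
    proof -
      have prod_upd: "(\<Prod>l\<in>UNIV. y l ^ (\<beta>(i := Suc (\<beta> i))) l) = y i * (\<Prod>l\<in>UNIV. y l ^ \<beta> l)" for \<beta>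
      proof -
        have "(\<Prod>l\<in>UNIV - {i}. y l ^ (\<beta>(i := Suc (\<beta> i))) l) = (\<Prod>l\<in>UNIV - {i}. y l ^ \<beta> l)"
          by (intro prod.cong) auto
        then show ?thesis by (simp add: prod.remove[of UNIV i] mult_ac)
      qed
      have "(\<Sum>\<gamma>\<in>multi_indices (Suc k). s i \<gamma> * (\<Prod>l\<in>UNIV. y l ^ \<gamma> l))
          = (\<Sum>\<gamma>\<in>{\<gamma>\<in>multi_indices (Suc k). \<gamma> i > 0}. s i \<gamma> * (\<Prod>l\<in>UNIV. y l ^ \<gamma> l))"
        by (intro sum.mono_neutral_right) (auto simp: s_def)
      also have "\<dots> = (\<Sum>\<beta>\<in>multi_indices k. m \<beta> * (y i * (\<Prod>l\<in>UNIV. y l ^ \<beta> l)))"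
      proof (rule sum.reindex_bij_witness[of _ "\<lambda>\<beta>. \<beta>(i := Suc (\<beta> i))" "\<lambda>\<gamma>. \<gamma>(i := \<gamma> i - 1)"])
        fix \<gamma> assume \<gamma>: "\<gamma> \<in> {\<gamma> \<in> multi_indices (Suc k). \<gamma> i > 0}"
        then have restore: "(\<gamma>(i := \<gamma> i - 1))(i := Suc ((\<gamma>(i := \<gamma> i - 1)) i)) = \<gamma>" by auto
        show "(\<gamma>(i := \<gamma> i - 1))(i := Suc ((\<gamma>(i := \<gamma> i - 1)) i)) = \<gamma>" by (fact restore)
        show "\<gamma>(i := \<gamma> i - 1) \<in> multi_indices k" using \<gamma> lower by blast
        show "m (\<gamma>(i := \<gamma> i - 1)) * (y i * (\<Prod>l\<in>UNIV. y l ^ (\<gamma>(i := \<gamma> i - 1)) l))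
            = s i \<gamma> * (\<Prod>l\<in>UNIV. y l ^ \<gamma> l)"
          using \<gamma> unfolding prod_upd[symmetric] restore by (simp add: s_def)
      qed (use raise in auto)
      finally show ?thesis by (simp add: sum_distrib_left mult_ac)
    qed
    have stay: "(\<Sum>\<beta>\<in>multi_indices k. m \<beta> * (\<Prod>l\<in>UNIV. y l ^ \<beta> l))
        = (\<Sum>\<gamma>\<in>multi_indices (Suc k). t \<gamma> * (\<Prod>l\<in>UNIV. y l ^ \<gamma> l))"
      by (intro sum.mono_neutral_cong_left) (use mono_sub in \<open>auto simp: t_def\<close>)
    have "(1 + (\<Sum>i\<in>UNIV. y i)) ^ Suc k
        = (\<Sum>\<beta>\<in>multi_indices k. m \<beta> * (\<Prod>l\<in>UNIV. y l ^ \<beta> l))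
          + (\<Sum>i\<in>UNIV. y i * (\<Sum>\<beta>\<in>multi_indices k. m \<beta> * (\<Prod>l\<in>UNIV. y l ^ \<beta> l)))"
      by (simp add: exp distrib_right sum_distrib_right)
    also have "\<dots> = (\<Sum>\<gamma>\<in>multi_indices (Suc k). t \<gamma> * (\<Prod>l\<in>UNIV. y l ^ \<gamma> l))
          + (\<Sum>\<gamma>\<in>multi_indices (Suc k). \<Sum>i\<in>UNIV. s i \<gamma> * (\<Prod>l\<in>UNIV. y l ^ \<gamma> l))"
      unfolding step unfolding stay sum.swap[of _ UNIV] ..
    finally show ?thesis
      by (simp add: sum.distrib distrib_right sum_distrib_right)
  qed
  with pos' show ?case by (intro exI[of _ "\<lambda>\<gamma>. t \<gamma> + (\<Sum>i\<in>UNIV. s i \<gamma>)"]) blast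
qed

text \<open>
  The powers of the affine forms $1 + \epsilon\,\alpha \cdot x$ with $\alpha$ on the principal
  lattice span all polynomials of degree at most $k$, and there are exactly as many of them as
  monomials. As a function of $\alpha$ such a power is a polynomial whose coefficient at
  $\alpha^\beta$ is a nonzero multiple of $x^\beta$. The tensor product of divided differences of
  order $\gamma$ in $\alpha$ kills $\alpha^\beta$ unless $\gamma \le \beta$ componentwise, and
  samples only lattice points $\alpha \le \gamma$. Applied to the power it therefore yields
  $x^\gamma$ up to monomials of strictly larger total degree, and downward induction on that degree
  removes the latter.
\<close>

lemma monomial_in_span_affine_powers:
  fixes \<epsilon> :: real
  assumes "\<epsilon> \<noteq> 0" and "\<gamma> \<in> multi_indices k"
  shows "\<exists>c. \<forall>x :: real ^ 'n. (\<Prod>i\<in>UNIV. (x $ i) ^ \<gamma> i)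
      = (\<Sum>\<alpha>\<in>multi_indices k. c \<alpha> * (1 + \<epsilon> * (\<Sum>i\<in>UNIV. real (\<alpha> i) * x $ i)) ^ k)"
  using assms(2)
proof (induction \<gamma> rule: measure_induct_rule[where f = "\<lambda>\<gamma>. k - (\<Sum>i\<in>UNIV. \<gamma> i)"])
  case (less \<gamma>)
  define mon where "mon \<beta> x = (\<Prod>i\<in>UNIV. (x $ i) ^ \<beta> i)" for \<beta> :: "'n \<Rightarrow> nat" and x :: "real ^ 'n"
  define pw where "pw \<alpha> x = (1 + \<epsilon> * (\<Sum>i\<in>UNIV. real (\<alpha> i) * x $ i)) ^ k"
    for \<alpha> :: "'n \<Rightarrow> nat" and x :: "real ^ 'n"
  obtain m :: "('n \<Rightarrow> nat) \<Rightarrow> real" where m_pos: "\<And>\<beta>. \<beta> \<in> multi_indices k \<Longrightarrow> m \<beta> > 0"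
    and multinomial: "\<And>y. (1 + (\<Sum>i\<in>UNIV. y i)) ^ k
        = (\<Sum>\<beta>\<in>multi_indices k. m \<beta> * (\<Prod>i\<in>UNIV. y i ^ \<beta> i))"
    using ex_multinomial_coefficients[of k] by blast
  obtain w :: "nat \<Rightarrow> nat \<Rightarrow> real" where w: "\<forall>g. (\<forall>j>g. w g j = 0)
      \<and> (\<forall>b<g. (\<Sum>j\<le>g. w g j * real j ^ b) = 0) \<and> (\<Sum>j\<le>g. w g j * real j ^ g) = 1"
    using choice[OF allI[OF ex_divided_difference_weights]] by (rule exE)
  then have w0: "\<And>g j. j > g \<Longrightarrow> w g j = 0"
    and wlt: "\<And>g b. b < g \<Longrightarrow> (\<Sum>j\<le>g. w g j * real j ^ b) = 0"
    and weq: "\<And>g. (\<Sum>j\<le>g. w g j * real j ^ g) = 1"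
    by simp_all
  define W where "W \<alpha> = (\<Prod>i\<in>UNIV. w (\<gamma> i) (\<alpha> i))" for \<alpha> :: "'n \<Rightarrow> nat"
  define T where "T \<beta> = (\<Prod>i\<in>UNIV. \<Sum>j\<le>\<gamma> i. w (\<gamma> i) j * real j ^ \<beta> i)" for \<beta> :: "'n \<Rightarrow> nat"
  \<comment> \<open>The product of the one-dimensional weights vanishes outside the box \<open>\<alpha> \<le> \<gamma>\<close>, which lies in the lattice;
    hence the lattice sum factorizes.\<close>
  have T_moment: "(\<Sum>\<alpha>\<in>multi_indices k. W \<alpha> * (\<Prod>i\<in>UNIV. real (\<alpha> i) ^ \<beta> i)) = T \<beta>" for \<beta>
  proof -
    have "T \<beta> = (\<Sum>\<alpha>\<in>PiE UNIV (\<lambda>i. {..\<gamma> i}). \<Prod>i\<in>UNIV. w (\<gamma> i) (\<alpha> i) * real (\<alpha> i) ^ \<beta> i)"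
      unfolding T_def by (rule prod_sum_PiE) auto
    also have "\<dots> = (\<Sum>\<alpha>\<in>PiE UNIV (\<lambda>i. {..\<gamma> i}). W \<alpha> * (\<Prod>i\<in>UNIV. real (\<alpha> i) ^ \<beta> i))"
      by (simp add: W_def prod.distrib)
    also have "\<dots> = (\<Sum>\<alpha>\<in>multi_indices k. W \<alpha> * (\<Prod>i\<in>UNIV. real (\<alpha> i) ^ \<beta> i))"
    proof (rule sum.mono_neutral_left)
      show "PiE UNIV (\<lambda>i. {..\<gamma> i}) \<subseteq> multi_indices k"
      proof
        fix \<alpha> assume "\<alpha> \<in> PiE UNIV (\<lambda>i. {..\<gamma> i})"
        then have "(\<Sum>i\<in>UNIV. \<alpha> i) \<le> (\<Sum>i\<in>UNIV. \<gamma> i)"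
          by (intro sum_mono) auto
        with less.prems show "\<alpha> \<in> multi_indices k" by (simp add: multi_indices_def)
      qed
      show "\<forall>\<alpha>\<in>multi_indices k - PiE UNIV (\<lambda>i. {..\<gamma> i}). W \<alpha> * (\<Prod>i\<in>UNIV. real (\<alpha> i) ^ \<beta> i) = 0"
      proof
        fix \<alpha> assume "\<alpha> \<in> multi_indices k - PiE UNIV (\<lambda>i. {..\<gamma> i})"
        then have "\<not> (\<forall>i. \<alpha> i \<le> \<gamma> i)" by (auto simp: PiE_UNIV_domain)
        then obtain i where "\<alpha> i > \<gamma> i" by (auto simp: not_le)
        then have "W \<alpha> = 0" unfolding W_def by (intro prod_zero) (auto intro: w0)
        then show "W \<alpha> * (\<Prod>i\<in>UNIV. real (\<alpha> i) ^ \<beta> i) = 0" by simp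
      qed
    qed simp
    finally show ?thesis by simp
  qed
  have T_diag: "T \<gamma> = 1" by (simp add: T_def weq)
  have T_zero: "T \<beta> = 0" if "(\<Sum>i\<in>UNIV. \<beta> i) \<le> (\<Sum>i\<in>UNIV. \<gamma> i)" "\<beta> \<noteq> \<gamma>" for \<beta>
  proof -
    have "\<exists>i. \<beta> i < \<gamma> i"
    proof (rule ccontr)
      assume "\<nexists>i. \<beta> i < \<gamma> i"
      then have le: "\<gamma> i \<le> \<beta> i" for i by (simp add: not_less)
      obtain i where "\<beta> i \<noteq> \<gamma> i" using \<open>\<beta> \<noteq> \<gamma>\<close> by auto
      with le[of i] have "\<gamma> i < \<beta> i" by simp
      then have "(\<Sum>i\<in>UNIV. \<gamma> i) < (\<Sum>i\<in>UNIV. \<beta> i)"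
        by (intro sum_strict_mono_ex1) (use le in auto)
      with that show False by simp
    qed
    then show ?thesis unfolding T_def by (auto intro!: prod_zero wlt)
  qed
  define s where "s \<beta> = m \<beta> * \<epsilon> ^ (\<Sum>i\<in>UNIV. \<beta> i) * T \<beta>" for \<beta> :: "'n \<Rightarrow> nat"
  define H :: "('n \<Rightarrow> nat) set" where "H = {\<beta> \<in> multi_indices k. (\<Sum>i\<in>UNIV. \<gamma> i) < (\<Sum>i\<in>UNIV. \<beta> i)}"
  have diff: "(\<Sum>\<alpha>\<in>multi_indices k. W \<alpha> * pw \<alpha> x) = s \<gamma> * mon \<gamma> x + (\<Sum>\<beta>\<in>H. s \<beta> * mon \<beta> x)" for x
  proof -
    have "pw \<alpha> x = (\<Sum>\<beta>\<in>multi_indices k. m \<beta> * (\<epsilon> ^ (\<Sum>i\<in>UNIV. \<beta> i)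
        * (\<Prod>i\<in>UNIV. real (\<alpha> i) ^ \<beta> i) * mon \<beta> x))" for \<alpha>
    proof -
      have "pw \<alpha> x = (1 + (\<Sum>i\<in>UNIV. \<epsilon> * real (\<alpha> i) * x $ i)) ^ k"
        by (simp add: pw_def sum_distrib_left mult.assoc)
      then show ?thesis
        by (simp add: multinomial power_mult_distrib prod.distrib mon_def power_sum)
    qed
    then have "(\<Sum>\<alpha>\<in>multi_indices k. W \<alpha> * pw \<alpha> x)
        = (\<Sum>\<alpha>\<in>multi_indices k. \<Sum>\<beta>\<in>multi_indices k. m \<beta> * \<epsilon> ^ (\<Sum>i\<in>UNIV. \<beta> i)
            * (W \<alpha> * (\<Prod>i\<in>UNIV. real (\<alpha> i) ^ \<beta> i)) * mon \<beta> x)"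
      by (simp add: sum_distrib_left mult_ac)
    also have "\<dots> = (\<Sum>\<beta>\<in>multi_indices k. s \<beta> * mon \<beta> x)"
      by (subst sum.swap) (simp add: s_def flip: T_moment sum_distrib_left sum_distrib_right)
    also have "\<dots> = (\<Sum>\<beta>\<in>insert \<gamma> H. s \<beta> * mon \<beta> x)"
    proof (rule sum.mono_neutral_right)
      show "\<forall>\<beta>\<in>multi_indices k - insert \<gamma> H. s \<beta> * mon \<beta> x = 0"
        using T_zero by (auto simp: H_def s_def)
    qed (use less.prems in \<open>auto simp: H_def\<close>)
    also have "\<dots> = s \<gamma> * mon \<gamma> x + (\<Sum>\<beta>\<in>H. s \<beta> * mon \<beta> x)"
      by (subst sum.insert) (auto simp: H_def)
    finally show ?thesis .
  qed
  have "\<exists>c. \<forall>x. mon \<beta> x = (\<Sum>\<alpha>\<in>multi_indices k. c \<alpha> * pw \<alpha> x)" if "\<beta> \<in> H" for \<beta>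
    unfolding mon_def pw_def
  proof (rule less.IH)
    show "k - (\<Sum>i\<in>UNIV. \<beta> i) < k - (\<Sum>i\<in>UNIV. \<gamma> i)" "\<beta> \<in> multi_indices k"
      using that by (auto simp: H_def multi_indices_def)
  qed
  then obtain K where K: "\<And>\<beta> x. \<beta> \<in> H \<Longrightarrow> mon \<beta> x = (\<Sum>\<alpha>\<in>multi_indices k. K \<beta> \<alpha> * pw \<alpha> x)"
    by metis
  have "s \<gamma> \<noteq> 0"
    using m_pos[OF less.prems] \<open>\<epsilon> \<noteq> 0\<close> by (simp add: s_def T_diag)
  \<comment> \<open>Solve \<open>diff\<close> for the monomial of exponent \<open>\<gamma>\<close>, the others being known by induction.\<close>
  have "mon \<gamma> x = (\<Sum>\<alpha>\<in>multi_indices k. (W \<alpha> - (\<Sum>\<beta>\<in>H. s \<beta> * K \<beta> \<alpha>)) / s \<gamma> * pw \<alpha> x)" for x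
  proof -
    have "(\<Sum>\<beta>\<in>H. s \<beta> * mon \<beta> x) = (\<Sum>\<beta>\<in>H. \<Sum>\<alpha>\<in>multi_indices k. s \<beta> * K \<beta> \<alpha> * pw \<alpha> x)"
      by (intro sum.cong refl) (simp add: K sum_distrib_left mult.assoc)
    also have "\<dots> = (\<Sum>\<alpha>\<in>multi_indices k. (\<Sum>\<beta>\<in>H. s \<beta> * K \<beta> \<alpha>) * pw \<alpha> x)"
      by (subst sum.swap) (simp add: sum_distrib_right)
    finally have "s \<gamma> * mon \<gamma> x
        = (\<Sum>\<alpha>\<in>multi_indices k. (W \<alpha> - (\<Sum>\<beta>\<in>H. s \<beta> * K \<beta> \<alpha>)) * pw \<alpha> x)"
      using diff[of x] by (simp add: left_diff_distrib sum_subtractf)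
    then have "mon \<gamma> x = (\<Sum>\<alpha>\<in>multi_indices k. (W \<alpha> - (\<Sum>\<beta>\<in>H. s \<beta> * K \<beta> \<alpha>)) * pw \<alpha> x) / s \<gamma>"
      using \<open>s \<gamma> \<noteq> 0\<close> by (simp add: field_simps)
    then show ?thesis by (simp add: sum_divide_distrib)
  qed
  then show ?case unfolding mon_def pw_def by (intro exI[of _ "\<lambda>\<alpha>. (W \<alpha> - (\<Sum>\<beta>\<in>H. s \<beta> * K \<beta> \<alpha>)) / s \<gamma>"] allI)
qed

text \<open>
  Adding the slack $k - \sum_i \alpha_i$ as a further entry turns multi-indices of degree at most $k$
  into lists of fixed length with sum exactly $k$.
\<close>

lemma card_multi_indices:
  "card (multi_indices k :: ('n::finite \<Rightarrow> nat) set) = (CARD('n) + k) choose CARD('n)"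
proof -
  obtain xs :: "'n list" where xs: "set xs = UNIV" "distinct xs"
    using finite_distinct_list[OF finite_class.finite_UNIV] by blast
  have len: "length xs = CARD('n)" using xs distinct_card by metis
  have sum_xs: "sum_list (map \<alpha> xs) = (\<Sum>i\<in>UNIV. \<alpha> i)" for \<alpha> :: "'n \<Rightarrow> nat"
    using xs sum_list_distinct_conv_sum_set by metis
  define L where "L = {l :: nat list. length l = Suc (CARD('n)) \<and> sum_list l = k}"
  define F where "F \<alpha> = (k - (\<Sum>i\<in>UNIV. \<alpha> i)) # map \<alpha> xs" for \<alpha> :: "'n \<Rightarrow> nat"
  have "bij_betw F (multi_indices k) L"
    unfolding bij_betw_def
  proof
    show "inj_on F (multi_indices k)"
      by (auto intro!: inj_onI simp: F_def xs)
    show "F ` multi_indices k = L"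
    proof (intro equalityI subsetI)
      fix l assume "l \<in> F ` multi_indices k"
      then show "l \<in> L" by (auto simp: F_def L_def len sum_xs multi_indices_def)
    next
      fix l assume "l \<in> L"
      then obtain s t where l: "l = s # t" and t: "length t = length xs" "s + sum_list t = k"
        by (auto simp: L_def len length_Suc_conv)
      define \<alpha> where "\<alpha> i = the (map_of (zip xs t) i)" for i
      have "map \<alpha> xs = t"
        using t(1) xs(2) by (auto intro!: nth_equalityI simp: \<alpha>_def map_of_zip_nth)
      moreover from this have "(\<Sum>i\<in>UNIV. \<alpha> i) = sum_list t"
        using sum_xs by metis
      ultimately show "l \<in> F ` multi_indices k"
        using t by (intro image_eqI[of _ _ \<alpha>]) (auto simp: F_def l multi_indices_def)
    qed
  qed
  then have "card (multi_indices k :: ('n \<Rightarrow> nat) set) = card L"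
    by (rule bij_betw_same_card)
  also have "\<dots> = (k + CARD('n)) choose k"
    unfolding L_def card_length_sum_list by simp
  also have "\<dots> = (CARD('n) + k) choose CARD('n)"
    using binomial_symmetric[of k "k + CARD('n)"] by (simp add: add.commute)
  finally show ?thesis .
qed

section \<open>Networks with neurons indexed by finite sets\<close>

text \<open>
  The functions that a neuron of the second hidden layer can receive as input, for first-layer
  neurons indexed by \<open>I\<close>. An arbitrary index set makes it possible to name neurons after the
  geometric objects that they serve.
\<close>

definition preactivations ::
    "'i set \<Rightarrow> ('i \<Rightarrow> real ^ 'n) \<Rightarrow> ('i \<Rightarrow> real) \<Rightarrow> (real ^ 'n \<Rightarrow> real) set" where
  "preactivations I a c = {g. \<exists>u u' s. \<forall>x. g x
      = (\<Sum>i\<in>I. u i * activation 0 (a i \<bullet> x + c i)) + (\<Sum>i\<in>I. u' i * activation 1 (a i \<bullet> x + c i)) + s}"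

text \<open>
  Neurons may be indexed by arbitrary finite sets: an enumeration of the index sets translates such
  a network into one with numbered neurons and the same widths.
\<close>

lemma NN_finite_indexI:
  fixes f :: "real ^ 'n \<Rightarrow> real ^ 'm" and a :: "'i \<Rightarrow> real ^ 'n" and w :: "'m \<Rightarrow> 'q \<Rightarrow> real"
  assumes "finite I" "finite Q"
    and pre: "\<And>q. q \<in> Q \<Longrightarrow> g q \<in> preactivations I a c"
    and f: "\<And>x l. f x $ l = (\<Sum>q\<in>Q. w l q * activation k (g q x))"
  shows "f \<in> NN k (card I) (card Q)"
proof -
  have "\<forall>q\<in>Q. \<exists>u u' s. \<forall>x. g q x = (\<Sum>i\<in>I. u i * activation 0 (a i \<bullet> x + c i))
      + (\<Sum>i\<in>I. u' i * activation 1 (a i \<bullet> x + c i)) + s"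
    using pre unfolding preactivations_def by blast
  from bchoice[OF this] obtain u where "\<forall>q\<in>Q. \<exists>u' s. \<forall>x. g q x
      = (\<Sum>i\<in>I. u q i * activation 0 (a i \<bullet> x + c i))
        + (\<Sum>i\<in>I. u' i * activation 1 (a i \<bullet> x + c i)) + s" by (rule exE)
  from bchoice[OF this] obtain u' where "\<forall>q\<in>Q. \<exists>s. \<forall>x. g q x
      = (\<Sum>i\<in>I. u q i * activation 0 (a i \<bullet> x + c i))
        + (\<Sum>i\<in>I. u' q i * activation 1 (a i \<bullet> x + c i)) + s" by (rule exE)
  from bchoice[OF this] obtain s where g: "\<forall>q\<in>Q. \<forall>x. g q x
      = (\<Sum>i\<in>I. u q i * activation 0 (a i \<bullet> x + c i))
        + (\<Sum>i\<in>I. u' q i * activation 1 (a i \<bullet> x + c i)) + s q" by (rule exE)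
  obtain e where e: "bij_betw e {..<card I} I"
    using bij_betw_from_nat_into_finite[OF \<open>finite I\<close>] by blast
  obtain p where p: "bij_betw p {..<card Q} Q"
    using bij_betw_from_nat_into_finite[OF \<open>finite Q\<close>] by blast
  have inner: "(\<Sum>i\<in>UNIV. a j $ i * x $ i) = a j \<bullet> x" for j x
    by (simp add: inner_vec_def)
  have I_sum: "(\<Sum>j<card I. h (e j)) = (\<Sum>i\<in>I. h i)" for h :: "'i \<Rightarrow> real"
    by (rule sum.reindex_bij_betw[OF e])
  have "f x $ l = (\<Sum>j<card Q. w l (p j) * activation k (g (p j) x))" for x l
    unfolding f by (rule sum.reindex_bij_betw[OF p, symmetric])
  also have "(\<Sum>j<card Q. w l (p j) * activation k (g (p j) x))
      = (\<Sum>q<card Q. w l (p q) * activation k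
          ((\<Sum>j<card I. u (p q) (e j) * activation 0 (a (e j) \<bullet> x + c (e j)))
           + (\<Sum>j<card I. u' (p q) (e j) * activation 1 (a (e j) \<bullet> x + c (e j))) + s (p q)))" for x l
  proof (rule sum.cong[OF refl])
    fix q assume "q \<in> {..<card Q}"
    then have "p q \<in> Q" using p by (auto simp: bij_betw_def)
    then show "w l (p q) * activation k (g (p q) x) = w l (p q) * activation k
          ((\<Sum>j<card I. u (p q) (e j) * activation 0 (a (e j) \<bullet> x + c (e j)))
           + (\<Sum>j<card I. u' (p q) (e j) * activation 1 (a (e j) \<bullet> x + c (e j))) + s (p q))"
      using g I_sum[of "\<lambda>i. u (p q) i * activation 0 (a i \<bullet> x + c i)"]
        I_sum[of "\<lambda>i. u' (p q) i * activation 1 (a i \<bullet> x + c i)"] by simp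
  qed
  finally show ?thesis
    unfolding NN_def mem_Collect_eq Let_def
    by (intro exI[of _ "\<lambda>j i. a (e j) $ i"] exI[of _ "\<lambda>j. c (e j)"]
        exI[of _ "\<lambda>q j. u (p q) (e j)"] exI[of _ "\<lambda>q j. u' (p q) (e j)"]
        exI[of _ "\<lambda>q. s (p q)"] exI[of _ "\<lambda>l q. w l (p q)"])
      (simp add: inner vec_eq_iff)
qed

lemma preactivations_const: "(\<lambda>_. r) \<in> preactivations I a c"
  unfolding preactivations_def
  by (rule CollectI, rule exI[of _ "\<lambda>_. 0"], rule exI[of _ "\<lambda>_. 0"]) auto

lemma preactivations_add:
  assumes "f \<in> preactivations I a c" "g \<in> preactivations I a c"
  shows "(\<lambda>x. f x + g x) \<in> preactivations I a c"
proof -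
  obtain u u' s v v' t where
    "\<And>x. f x = (\<Sum>i\<in>I. u i * activation 0 (a i \<bullet> x + c i)) + (\<Sum>i\<in>I. u' i * activation 1 (a i \<bullet> x + c i)) + s"
    "\<And>x. g x = (\<Sum>i\<in>I. v i * activation 0 (a i \<bullet> x + c i)) + (\<Sum>i\<in>I. v' i * activation 1 (a i \<bullet> x + c i)) + t"
    using assms unfolding preactivations_def by blast
  then show ?thesis
    unfolding preactivations_def
    by (intro CollectI exI[of _ "\<lambda>i. u i + v i"] exI[of _ "\<lambda>i. u' i + v' i"] exI[of _ "s + t"])
      (simp add: distrib_right sum.distrib)
qed

lemma preactivations_scale:
  assumes "f \<in> preactivations I a c"
  shows "(\<lambda>x. r * f x) \<in> preactivations I a c"
proof -
  obtain u u' s where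
    "\<And>x. f x = (\<Sum>i\<in>I. u i * activation 0 (a i \<bullet> x + c i)) + (\<Sum>i\<in>I. u' i * activation 1 (a i \<bullet> x + c i)) + s"
    using assms unfolding preactivations_def by blast
  then show ?thesis
    unfolding preactivations_def
    by (intro CollectI exI[of _ "\<lambda>i. r * u i"] exI[of _ "\<lambda>i. r * u' i"] exI[of _ "r * s"])
      (simp add: distrib_left sum_distrib_left mult.assoc)
qed

lemma preactivations_diff:
  assumes "f \<in> preactivations I a c" "g \<in> preactivations I a c"
  shows "(\<lambda>x. f x - g x) \<in> preactivations I a c"
  using preactivations_add[OF assms(1) preactivations_scale[OF assms(2), of "-1"]] by simp

lemma preactivations_sum:
  assumes "\<And>t. t \<in> A \<Longrightarrow> f t \<in> preactivations I a c"
  shows "(\<lambda>x. \<Sum>t\<in>A. f t x) \<in> preactivations I a c"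
  using assms
  by (induction A rule: infinite_finite_induct)
    (simp_all add: preactivations_const preactivations_add)

lemma preactivations_step:
  assumes "finite I" "i \<in> I"
  shows "(\<lambda>x. activation 0 (a i \<bullet> x + c i)) \<in> preactivations I a c"
  unfolding preactivations_def
  by (intro CollectI exI[of _ "\<lambda>j. if j = i then 1 else 0"] exI[of _ "\<lambda>_. 0"] exI[of _ 0])
    (simp add: assms if_distrib[of "\<lambda>t. t * _"] cong: if_cong)

lemma preactivations_relu:
  assumes "finite I" "i \<in> I"
  shows "(\<lambda>x. activation 1 (a i \<bullet> x + c i)) \<in> preactivations I a c"
  unfolding preactivations_def
  by (intro CollectI exI[of _ "\<lambda>_. 0"] exI[of _ "\<lambda>j. if j = i then 1 else 0"] exI[of _ 0])
    (simp add: assms if_distrib[of "\<lambda>t. t * _"] cong: if_cong)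

text \<open>
  Each hyperplane carries two first-layer neurons, with opposite orientations. The two Heaviside
  values tell its three sign classes (either side, or on it) apart, and the two ReLU values add up to
  the affine function itself, because $t = \max(t,0) - \max(-t,0)$.
\<close>

abbreviation two_sided ::
    "('h \<Rightarrow> real ^ 'n) \<Rightarrow> ('h \<Rightarrow> real) \<Rightarrow> 'h set \<Rightarrow> (real ^ 'n \<Rightarrow> real) set" where
  "two_sided n c H \<equiv> preactivations (H \<times> (UNIV :: bool set))
     (\<lambda>(h, pos). if pos then n h else - n h) (\<lambda>(h, pos). if pos then c h else - c h)"

lemma two_sided_affine:
  assumes "finite H" "h \<in> H"
  shows "(\<lambda>x. r * (n h \<bullet> x + c h)) \<in> two_sided n c H"
proof -
  have "(\<lambda>x. r * (activation 1 (n h \<bullet> x + c h) - activation 1 (- n h \<bullet> x + - c h))) \<in> two_sided n c H"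
    using assms preactivations_relu[of "H \<times> UNIV" "(h, True)" "\<lambda>(h, pos). if pos then n h else - n h"
        "\<lambda>(h, pos). if pos then c h else - c h"]
      preactivations_relu[of "H \<times> UNIV" "(h, False)" "\<lambda>(h, pos). if pos then n h else - n h"
        "\<lambda>(h, pos). if pos then c h else - c h"]
    by (intro preactivations_scale preactivations_diff) simp_all
  moreover have "r * (activation 1 (n h \<bullet> x + c h) - activation 1 (- n h \<bullet> x + - c h))
      = r * (n h \<bullet> x + c h)" for x
    by (simp add: activation_def max_def)
  ultimately show ?thesis by (simp only:)
qed

lemma two_sided_step:
  assumes "finite H" "h \<in> H"
  shows "(\<lambda>x. activation 0 (r * (n h \<bullet> x + c h))) \<in> two_sided n c H"
proof -
  have plus: "(\<lambda>x. activation 0 (n h \<bullet> x + c h)) \<in> two_sided n c H"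
    and minus: "(\<lambda>x. activation 0 (- n h \<bullet> x + - c h)) \<in> two_sided n c H"
    using assms preactivations_step[of "H \<times> UNIV" "(h, True)" "\<lambda>(h, pos). if pos then n h else - n h"
        "\<lambda>(h, pos). if pos then c h else - c h"]
      preactivations_step[of "H \<times> UNIV" "(h, False)" "\<lambda>(h, pos). if pos then n h else - n h"
        "\<lambda>(h, pos). if pos then c h else - c h"] by simp_all
  consider "r > 0" | "r < 0" | "r = 0" by linarith
  then show ?thesis
  proof cases
    case 1
    then have "activation 0 (r * t) = activation 0 t" for t
      by (simp add: activation_def zero_less_mult_iff)
    then show ?thesis using plus by simp
  next
    case 2
    then have "activation 0 (r * t) = activation 0 (- t)" for t
      by (auto simp add: activation_def zero_less_mult_iff)
    then show ?thesis using minus by simp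
  next
    case 3
    then show ?thesis by (simp add: preactivations_const)
  qed
qed

section \<open>Simplices and their faces\<close>

text \<open>
  For each vertex, the equation of the opposite facet hyperplane, divided by its value at the vertex,
  is the barycentric coordinate of that vertex. Any equation of the hyperplane will do,
  so one equation per hyperplane serves all elements with a facet in it.
\<close>

lemma simplex_barycentric_coordinates:
  fixes V :: "'a::euclidean_space set" and n :: "'a set \<Rightarrow> 'a" and c :: "'a set \<Rightarrow> real"
  assumes ind: "\<not> affine_dependent V" and card: "card V = Suc DIM('a)"
    and hyp: "\<And>v. v \<in> V \<Longrightarrow>
      affine hull (V - {v}) = {x. n (affine hull (V - {v})) \<bullet> x + c (affine hull (V - {v})) = 0}"
  obtains L :: "'a \<Rightarrow> 'a \<Rightarrow> real" and r :: "'a \<Rightarrow> real" where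
    "\<And>v x. L v x = r v * (n (affine hull (V - {v})) \<bullet> x + c (affine hull (V - {v})))"
    "\<And>x. (\<Sum>v\<in>V. L v x) = 1"
    "\<And>x. (\<Sum>v\<in>V. L v x *\<^sub>R v) = x"
    "\<And>u w. sum u V = 1 \<Longrightarrow> w \<in> V \<Longrightarrow> L w (\<Sum>v\<in>V. u v *\<^sub>R v) = u w"
proof -
  have fin: "finite V" using ind by (rule aff_independent_finite)
  define z where "z v x = n (affine hull (V - {v})) \<bullet> x + c (affine hull (V - {v}))" for v x
  define L where "L v x = (1 / z v v) * z v x" for v x
  \<comment> \<open>A vertex does not lie on the opposite hyperplane, by affine independence.\<close>
  have off: "z v v \<noteq> 0" if "v \<in> V" for v
    using ind that hyp[OF that] unfolding affine_dependent_def z_def by blast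
  have on: "z v w = 0" if "v \<in> V" "w \<in> V" "w \<noteq> v" for v w
    using hyp[OF that(1)] hull_inc[of w "V - {v}" affine] that unfolding z_def by blast
  have eval: "L w (\<Sum>v\<in>V. u v *\<^sub>R v) = u w" if u: "sum u V = 1" and w: "w \<in> V" for u w
  proof -
    have "z w (\<Sum>v\<in>V. u v *\<^sub>R v) = (\<Sum>v\<in>V. u v * z w v)"
      by (simp add: z_def inner_sum_right distrib_left sum.distrib u flip: sum_distrib_right)
    also have "\<dots> = u w * z w w"
      using on[OF w] by (subst sum.remove[OF fin w]) simp
    finally show ?thesis using off[OF w] by (simp add: L_def)
  qed
  have repr: "(\<Sum>v\<in>V. L v x) = 1 \<and> (\<Sum>v\<in>V. L v x *\<^sub>R v) = x" for x
  proof -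
    have "x \<in> affine hull V"
      by (simp add: affine_independent_span_eq[OF ind card])
    then obtain u where u: "sum u V = 1" and x: "(\<Sum>v\<in>V. u v *\<^sub>R v) = x"
      unfolding affine_hull_finite[OF fin] by blast
    have "L w x = u w" if "w \<in> V" for w
      using eval[OF u that] by (simp add: x)
    then show ?thesis using u x by simp
  qed
  show thesis
    by (rule that[of L "\<lambda>v. 1 / z v v"]) (use repr eval in \<open>auto simp: L_def z_def\<close>)
qed

text \<open>
  A relatively open face is described within the whole space, not only within the simplex, by the signs
  of the barycentric coordinates: since the coordinates reproduce every point, those with the given
  signs are the coefficients of a convex combination.
\<close>

lemma rel_interior_face_barycentric:
  fixes V :: "'a::euclidean_space set" and L :: "'a \<Rightarrow> 'a \<Rightarrow> real"
  assumes ind: "\<not> affine_dependent V" and W: "W \<subseteq> V"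
    and one: "\<And>x. (\<Sum>v\<in>V. L v x) = 1" and repr: "\<And>x. (\<Sum>v\<in>V. L v x *\<^sub>R v) = x"
    and eval: "\<And>u w. sum u V = 1 \<Longrightarrow> w \<in> V \<Longrightarrow> L w (\<Sum>v\<in>V. u v *\<^sub>R v) = u w"
  shows "rel_interior (convex hull W) = {x. (\<forall>v\<in>W. L v x > 0) \<and> (\<forall>v\<in>V - W. L v x = 0)}"
proof -
  have fin: "finite V" using ind by (rule aff_independent_finite)
  have indW: "\<not> affine_dependent W"
    using ind W affine_dependent_subset by blast
  show ?thesis
    unfolding rel_interior_convex_hull_explicit[OF indW]
  proof (intro equalityI subsetI)
    fix y assume "y \<in> {y. \<exists>u. (\<forall>x\<in>W. 0 < u x) \<and> sum u W = 1 \<and> (\<Sum>x\<in>W. u x *\<^sub>R x) = y}"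
    then obtain u :: "'a \<Rightarrow> real" where u: "\<forall>x\<in>W. 0 < u x" "sum u W = 1" and y: "(\<Sum>x\<in>W. u x *\<^sub>R x) = y"
      by blast
    define u' where "u' v = (if v \<in> W then u v else 0)" for v
    have "sum u' V = 1" 
      using u W fin by (simp add: u'_def sum.inter_restrict[symmetric] Int_absorb1)
    moreover have "(\<Sum>v\<in>V. u' v *\<^sub>R v) = (\<Sum>x\<in>W. u x *\<^sub>R x)"
      using W fin by (intro sum.mono_neutral_cong_right) (auto simp: u'_def)
    ultimately have "L v (\<Sum>x\<in>W. u x *\<^sub>R x) = u' v" if "v \<in> V" for v
      using eval[of u' v] that by simp
    then show "y \<in> {x. (\<forall>v\<in>W. L v x > 0) \<and> (\<forall>v\<in>V - W. L v x = 0)}"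
      unfolding y using W u by (auto simp: u'_def subset_iff)
  next
    fix x assume "x \<in> {x. (\<forall>v\<in>W. L v x > 0) \<and> (\<forall>v\<in>V - W. L v x = 0)}"
    then have pos: "\<forall>v\<in>W. 0 < L v x" and zero: "\<forall>v\<in>V - W. L v x = 0" by blast+
    have "(\<Sum>v\<in>W. L v x) = 1"
      using sum.mono_neutral_left[OF fin W, of "\<lambda>v. L v x"] zero one[of x] by simp
    moreover have "(\<Sum>v\<in>W. L v x *\<^sub>R v) = x"
      using sum.mono_neutral_left[OF fin W, of "\<lambda>v. L v x *\<^sub>R v"] zero repr[of x] by simp
    ultimately show "x \<in> {y. \<exists>u. (\<forall>x\<in>W. 0 < u x) \<and> sum u W = 1 \<and> (\<Sum>x\<in>W. u x *\<^sub>R x) = y}"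
      using pos by (intro CollectI exI[of _ "\<lambda>v. L v x"]) auto
  qed
qed

text \<open>
  The hyperplanes of a single simplex already provide everything that the neurons of its faces need.
  The mask counts the sign conditions that a point violates, each of which is a combination of
  Heaviside values. An affine function is the combination of the barycentric coordinates with its
  vertex values as coefficients.
\<close>

lemma two_sided_simplex:
  fixes V :: "(real ^ 'n) set"
  assumes ind: "\<not> affine_dependent V" and card: "card V = Suc DIM(real ^ 'n)"
    and H: "finite H" "\<And>v. v \<in> V \<Longrightarrow> affine hull (V - {v}) \<in> H"
    and hyp: "\<And>h. h \<in> H \<Longrightarrow> h = {x. n h \<bullet> x + c h = 0}"
  shows two_sided_face_mask: "W \<subseteq> V \<Longrightarrow> \<exists>m\<in>two_sided n c H. \<forall>x.
        (x \<in> rel_interior (convex hull W) \<longrightarrow> m x = 0) \<and> (x \<notin> rel_interior (convex hull W) \<longrightarrow> m x \<ge> 1)"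
    and two_sided_all_affine: "(\<lambda>x. a \<bullet> x + b) \<in> two_sided n c H"
proof -
  have fin: "finite V" using ind by (rule aff_independent_finite)
  obtain L r where L: "\<And>v x. L v x = r v * (n (affine hull (V - {v})) \<bullet> x + c (affine hull (V - {v})))"
    and one: "\<And>x. (\<Sum>v\<in>V. L v x) = 1" and repr: "\<And>x. (\<Sum>v\<in>V. L v x *\<^sub>R v) = x"
    and eval: "\<And>u w. sum u V = 1 \<Longrightarrow> w \<in> V \<Longrightarrow> L w (\<Sum>v\<in>V. u v *\<^sub>R v) = u w"
    by (rule simplex_barycentric_coordinates[OF ind card hyp[OF H(2)]]) (assumption | rule that)+
  have step: "(\<lambda>x. activation 0 (t * L v x)) \<in> two_sided n c H" if "v \<in> V" for v t
    using two_sided_step[OF H(1) H(2)[OF that], of "t * r v" n c] by (simp add: L mult.assoc)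
  have lin: "(\<lambda>x. L v x * t) \<in> two_sided n c H" if "v \<in> V" for v t
    using two_sided_affine[OF H(1) H(2)[OF that], of "t * r v" n c] by (simp add: L mult_ac)
  have "a \<bullet> x + b = (\<Sum>v\<in>V. L v x * (a \<bullet> v + b))" for x
  proof -
    have "(\<Sum>v\<in>V. L v x * (a \<bullet> v + b)) = a \<bullet> (\<Sum>v\<in>V. L v x *\<^sub>R v) + (\<Sum>v\<in>V. L v x) * b"
      by (simp add: distrib_left sum.distrib inner_sum_right sum_distrib_right)
    then show ?thesis by (simp add: one repr)
  qed
  then have "(\<lambda>x. a \<bullet> x + b) = (\<lambda>x. \<Sum>v\<in>V. L v x * (a \<bullet> v + b))" by (rule ext)
  then show "(\<lambda>x. a \<bullet> x + b) \<in> two_sided n c H"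
    by (rule ssubst) (intro preactivations_sum lin)
  show "\<exists>m\<in>two_sided n c H. \<forall>x. (x \<in> rel_interior (convex hull W) \<longrightarrow> m x = 0)
      \<and> (x \<notin> rel_interior (convex hull W) \<longrightarrow> m x \<ge> 1)" if W: "W \<subseteq> V"
  proof -
    define p where "p v x = (if v \<in> W then 1 - activation 0 (1 * L v x)
        else activation 0 (1 * L v x) + activation 0 (- 1 * L v x))" for v x
    have p_mem: "p v \<in> two_sided n c H" if "v \<in> V" for v
    proof (cases "v \<in> W")
      case True
      then show ?thesis
        using preactivations_diff[OF preactivations_const step[OF that, of 1], of 1]
        by (simp add: p_def[abs_def])
    next
      case False
      then show ?thesis
        using preactivations_add[OF step[OF that, of 1] step[OF that, of "-1"]]
        by (simp add: p_def[abs_def])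
    qed
    have p_nonneg: "p v x \<ge> 0" for v x
      by (simp add: p_def activation_def)
    have p_good: "p v x = 0" if "v \<in> W \<Longrightarrow> L v x > 0" "v \<notin> W \<Longrightarrow> L v x = 0" for v x
      using that by (simp add: p_def activation_def)
    have p_bad: "p v x = 1" if "\<not> (if v \<in> W then L v x > 0 else L v x = 0)" for v x
      using that by (auto simp: p_def activation_def split: if_splits)
    show ?thesis
    proof (intro bexI[of _ "\<lambda>x. \<Sum>v\<in>V. p v x"] allI conjI impI)
      show "(\<lambda>x. \<Sum>v\<in>V. p v x) \<in> two_sided n c H"
        using p_mem by (rule preactivations_sum)
      fix x
      have sign: "rel_interior (convex hull W) = {x. (\<forall>v\<in>W. L v x > 0) \<and> (\<forall>v\<in>V - W. L v x = 0)}"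
        by (rule rel_interior_face_barycentric[OF ind W one repr]) (rule eval)
      show "(\<Sum>v\<in>V. p v x) = 0" if "x \<in> rel_interior (convex hull W)"
        using that by (intro sum.neutral ballI p_good) (auto simp: sign)
      show "(\<Sum>v\<in>V. p v x) \<ge> 1" if "x \<notin> rel_interior (convex hull W)"
      proof -
        have "\<exists>v\<in>V. \<not> (if v \<in> W then L v x > 0 else L v x = 0)"
        proof (rule ccontr)
          assume "\<not> ?thesis"
          then have "x \<in> rel_interior (convex hull W)"
            using W unfolding sign by (auto split: if_splits)
          with that show False by contradiction
        qed
        then obtain v where v: "v \<in> V" "\<not> (if v \<in> W then L v x > 0 else L v x = 0)" by blast
        then show ?thesis
          using member_le_sum[of v V "\<lambda>v. p v x"] fin p_nonneg p_bad[OF v(2)] by simp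
      qed
    qed
  qed
qed

lemma conforming_meshD:
  assumes "conforming_mesh \<Omega> \<T>"
  shows conforming_mesh_finite: "finite \<T>"
    and conforming_mesh_open_simplex: "\<tau> \<in> \<T> \<Longrightarrow> open_simplex \<tau>"
    and conforming_mesh_closure: "(\<Union>\<tau>\<in>\<T>. closure \<tau>) = closure \<Omega>"
  using assms by (simp_all add: conforming_mesh_def)

lemma open_simplex_vertices:
  fixes \<tau> :: "'a::euclidean_space set"
  assumes "open_simplex \<tau>"
  obtains V where "\<not> affine_dependent V" "card V = Suc DIM('a)" "closure \<tau> = convex hull V"
proof -
  obtain V where V: "\<not> affine_dependent V" "int (card V) = int DIM('a) + 1"
      and \<tau>: "\<tau> = interior (convex hull V)"
    using assms unfolding open_simplex_def simplex_def by blast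
  have card: "card V = Suc DIM('a)" using V(2) by linarith
  have fin: "finite V" using V(1) by (rule aff_independent_finite)
  have "affine hull (convex hull V) = UNIV"
    by (simp add: affine_independent_span_eq[OF V(1) card])
  then have "interior (convex hull V) = rel_interior (convex hull V)"
    by (simp add: rel_interior_interior)
  also have "\<dots> \<noteq> {}" using card by (auto simp: rel_interior_eq_empty)
  finally have "closure \<tau> = closure (convex hull V)"
    unfolding \<tau> by (intro convex_closure_interior) auto
  then have "closure \<tau> = convex hull V"
    using fin by (simp add: finite_imp_compact)
  with V(1) card show thesis by (rule that)
qed

text \<open>
  The cardinality assumption guarantees that the simplex has at least two vertices, so that the face
  opposite to a vertex is nonempty and hence a facet.
\<close>

lemma facet_hyperplanes_simplex:
  fixes V :: "'a::euclidean_space set"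
  assumes "\<tau> \<in> \<T>" "\<not> affine_dependent V" "card V = Suc DIM('a)" "closure \<tau> = convex hull V" "v \<in> V"
  shows "affine hull (V - {v}) \<in> facet_hyperplanes \<T>"
proof -
  have "card (V - {v}) = DIM('a)" using assms by simp
  then have "V - {v} \<noteq> {}" using DIM_positive[where 'a = 'a] by (metis card.empty less_irrefl)
  then have "convex hull (V - {v}) facet_of closure \<tau>"
    using assms by (auto simp: facet_of_convex_hull_affine_independent)
  then show ?thesis
    unfolding facet_hyperplanes_def using assms(1) affine_hull_convex_hull[of "V - {v}"] by blast
qed

lemma facet_hyperplanes_equation:
  fixes \<T> :: "'a::euclidean_space set set"
  assumes "\<And>\<tau>. \<tau> \<in> \<T> \<Longrightarrow> open_simplex \<tau>" "h \<in> facet_hyperplanes \<T>"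
  shows "\<exists>a b. h = {x. a \<bullet> x + b = 0}"
proof -
  obtain F \<tau> where h: "h = affine hull F" and F: "\<tau> \<in> \<T>" "F facet_of closure \<tau>"
    using assms(2) unfolding facet_hyperplanes_def by blast
  obtain V where V: "\<not> affine_dependent V" "card V = Suc DIM('a)" "closure \<tau> = convex hull V"
    using open_simplex_vertices assms(1) F(1) by blast
  have "aff_dim F = aff_dim V - 1"
    using F(2) by (simp add: facet_of_def V(3) aff_dim_convex_hull)
  also have "aff_dim V = DIM('a)"
    using aff_dim_affine_independent[OF V(1)] V(2) by simp
  finally obtain a b where "affine hull F = {x. a \<bullet> x = b}"
    using aff_dim_eq_hyperplane[of F] by auto
  then have "h = {x. a \<bullet> x + - b = 0}" using h by auto
  then show ?thesis by blast
qed

lemma subsimplices_simplex: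
  fixes \<T> :: "'a::euclidean_space set set"
  assumes "\<And>\<tau>. \<tau> \<in> \<T> \<Longrightarrow> open_simplex \<tau>" "S \<in> subsimplices \<T>"
  obtains \<tau> V W where "\<tau> \<in> \<T>" "\<not> affine_dependent V" "card V = Suc DIM('a)" "closure \<tau> = convex hull V"
    "W \<subseteq> V" "S = rel_interior (convex hull W)"
proof -
  obtain F \<tau> where S: "S = rel_interior F" and F: "\<tau> \<in> \<T>" "F face_of closure \<tau>"
    using assms(2) unfolding subsimplices_def by blast
  obtain V where V: "\<not> affine_dependent V" "card V = Suc DIM('a)" "closure \<tau> = convex hull V"
    using open_simplex_vertices assms(1) F(1) by blast
  obtain W where "W \<subseteq> V" "F = convex hull W"
    using F(2) face_of_convex_hull_affine_independent[OF V(1)] unfolding V(3) by blast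
  with F(1) V S show thesis using that by blast
qed

lemma finite_facet_hyperplanes:
  fixes \<T> :: "'a::euclidean_space set set"
  assumes "finite \<T>" "\<And>\<tau>. \<tau> \<in> \<T> \<Longrightarrow> open_simplex \<tau>"
  shows "finite (facet_hyperplanes \<T>)"
proof -
  have "finite {F. F facet_of closure \<tau>}" if "\<tau> \<in> \<T>" for \<tau>
  proof -
    obtain V where "\<not> affine_dependent V" "card V = Suc DIM('a)" "closure \<tau> = convex hull V"
      using open_simplex_vertices[OF assms(2)[OF \<open>\<tau> \<in> \<T>\<close>]] by blast
    then have "polytope (closure \<tau>)"
      using aff_independent_finite unfolding polytope_def by blast
    then show ?thesis by (rule finite_polytope_facets)
  qed
  then have "finite (\<Union>\<tau>\<in>\<T>. (\<lambda>F. affine hull F) ` {F. F facet_of closure \<tau>})"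
    using assms(1) by blast
  moreover have "facet_hyperplanes \<T> \<subseteq> (\<Union>\<tau>\<in>\<T>. (\<lambda>F. affine hull F) ` {F. F facet_of closure \<tau>})"
    unfolding facet_hyperplanes_def by blast
  ultimately show ?thesis by (rule finite_subset[rotated])
qed

text \<open>
  Faces of a simplex correspond to sets of vertices, and nonempty faces to nonempty sets.
\<close>

lemma card_subsimplices_le:
  fixes \<T> :: "'a::euclidean_space set set"
  assumes "finite \<T>" "\<And>\<tau>. \<tau> \<in> \<T> \<Longrightarrow> open_simplex \<tau>"
  shows "finite (subsimplices \<T>) \<and> card (subsimplices \<T>) \<le> (2 ^ Suc DIM('a) - 1) * card \<T>"
proof -
  define A where "A \<tau> = rel_interior ` {F. F face_of closure \<tau> \<and> F \<noteq> {}}" for \<tau> :: "'a set"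
  have A: "finite (A \<tau>) \<and> card (A \<tau>) \<le> 2 ^ Suc DIM('a) - 1" if "\<tau> \<in> \<T>" for \<tau>
  proof -
    obtain V where V: "\<not> affine_dependent V" "card V = Suc DIM('a)" "closure \<tau> = convex hull V"
      using open_simplex_vertices[OF assms(2)[OF \<open>\<tau> \<in> \<T>\<close>]] by blast
    have fin: "finite V" using V(1) by (rule aff_independent_finite)
    have sub: "A \<tau> \<subseteq> (\<lambda>W. rel_interior (convex hull W)) ` (Pow V - {{}})"
      unfolding A_def V(3) face_of_convex_hull_affine_independent[OF V(1)] by fastforce
    have "card (Pow V - {{}}) = 2 ^ Suc DIM('a) - 1"
      using fin by (simp add: card_Pow V(2))
    then show ?thesis
      using surj_card_le[OF _ sub] finite_subset[OF sub] fin by (auto simp: card_Pow V(2))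
  qed
  have eq: "subsimplices \<T> = (\<Union>\<tau>\<in>\<T>. A \<tau>)"
    unfolding subsimplices_def A_def by blast
  have "card (subsimplices \<T>) \<le> (\<Sum>\<tau>\<in>\<T>. card (A \<tau>))"
    unfolding eq by (rule card_UN_le[OF assms(1)])
  also have "\<dots> \<le> (\<Sum>\<tau>\<in>\<T>. 2 ^ Suc DIM('a) - 1)"
    using A by (intro sum_mono) blast
  finally show ?thesis using A assms(1) by (auto simp: eq mult.commute)
qed

lemma subsimplices_cover:
  fixes \<T> :: "'a::euclidean_space set set"
  assumes "\<tau> \<in> \<T>" "open_simplex \<tau>" "x \<in> closure \<tau>"
  shows "\<exists>S\<in>subsimplices \<T>. x \<in> S"
proof -
  obtain V where V: "\<not> affine_dependent V" "closure \<tau> = convex hull V"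
    using open_simplex_vertices assms(2) by blast
  have fin: "finite V" using V(1) by (rule aff_independent_finite)
  obtain u where u: "\<And>v. v \<in> V \<Longrightarrow> 0 \<le> u v" "sum u V = 1" "(\<Sum>v\<in>V. u v *\<^sub>R v) = x"
    using assms(3) unfolding V(2) convex_hull_finite[OF fin] by blast
  define W where "W = {v \<in> V. u v > 0}"
  have W: "W \<subseteq> V" by (auto simp: W_def)
  have zero: "u v = 0" if "v \<in> V - W" for v
    using u(1)[of v] that by (auto simp: W_def)
  have "sum u W = 1" "(\<Sum>v\<in>W. u v *\<^sub>R v) = x"
    using sum.mono_neutral_left[OF fin W, of u] sum.mono_neutral_left[OF fin W, of "\<lambda>v. u v *\<^sub>R v"]
      zero u by auto
  moreover have "\<not> affine_dependent W" using V(1) W affine_dependent_subset by blast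
  ultimately have x: "x \<in> rel_interior (convex hull W)"
    by (auto simp: rel_interior_convex_hull_explicit W_def)
  then have "convex hull W \<noteq> {}" by auto
  moreover have "convex hull W face_of closure \<tau>"
    using W V by (auto simp: face_of_convex_hull_affine_independent)
  ultimately show ?thesis using x assms(1) unfolding subsimplices_def by blast
qed

text \<open>
  This is where conformity enters. If two relatively open subsimplices share a point, the intersection
  \<open>G\<close> of the closed elements containing them is a common face; it contains both
  subsimplices because it meets their relative interiors, and distinct faces of \<open>G\<close> have disjoint
  relative interiors.
\<close>

lemma subsimplices_disjoint:
  assumes "conforming_mesh \<Omega> \<T>" "S \<in> subsimplices \<T>" "S' \<in> subsimplices \<T>" "x \<in> S" "x \<in> S'"
  shows "S = S'"
proof -
  obtain F \<tau> where S: "S = rel_interior F" and F: "\<tau> \<in> \<T>" "F face_of closure \<tau>"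
    using assms(2) unfolding subsimplices_def by blast
  obtain F' \<tau>' where S': "S' = rel_interior F'" and F': "\<tau>' \<in> \<T>" "F' face_of closure \<tau>'"
    using assms(3) unfolding subsimplices_def by blast
  define G where "G = closure \<tau> \<inter> closure \<tau>'"
  have xF: "x \<in> F" "x \<in> F'"
    using assms(4,5) rel_interior_subset unfolding S S' by blast+
  have xG: "x \<in> G"
    using xF face_of_imp_subset[OF F(2)] face_of_imp_subset[OF F'(2)] by (auto simp: G_def)
  have G: "G face_of closure \<tau>" "G face_of closure \<tau>'"
  proof -
    have "convex (closure \<tau>)"
      using open_simplex_vertices[OF conforming_mesh_open_simplex[OF assms(1) F(1)]]
      by (metis convex_convex_hull)
    moreover have "G = {} \<or> G face_of closure \<tau> \<and> G face_of closure \<tau>'" if "\<tau> \<noteq> \<tau>'"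
      using assms(1) F(1) F'(1) that unfolding conforming_mesh_def G_def by blast
    ultimately show "G face_of closure \<tau>" "G face_of closure \<tau>'"
      using xG by (cases "\<tau> = \<tau>'"; auto simp: G_def face_of_refl)+
  qed
  have "F \<subseteq> G" 
    using subset_of_face_of[OF G(1) face_of_imp_subset[OF F(2)]] xG assms(4) S by blast
  moreover have "F' \<subseteq> G" 
    using subset_of_face_of[OF G(2) face_of_imp_subset[OF F'(2)]] xG assms(5) S' by blast
  ultimately have "F face_of G" "F' face_of G"
    using face_of_subset[OF F(2)] face_of_subset[OF F'(2)] by (auto simp: G_def)
  then have "F = F'"
    by (rule face_of_eq) (use assms(4,5) S S' in blast)
  then show ?thesis using S S' by simp
qed

section \<open>Realization of piecewise polynomials\<close>

lemma vec_polynomial_continuous: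
  fixes p :: "real ^ 'n \<Rightarrow> 'e::real_normed_vector"
  assumes "vec_polynomial k p"
  shows "continuous_on A p"
proof -
  obtain c where "p = (\<lambda>x. \<Sum>\<alpha>\<in>multi_indices k. (\<Prod>i\<in>UNIV. (x $ i) ^ \<alpha> i) *\<^sub>R c \<alpha>)"
    using assms unfolding vec_polynomial_def by blast
  then show ?thesis by (auto intro!: continuous_intros)
qed

text \<open>
  The polynomial of an element extends to the closure of the element by continuity of the spline, and
  every subsimplex lies in the closure of some element.
\<close>

lemma mesh_space_polynomial_on_subsimplex:
  fixes v :: "real ^ 'n \<Rightarrow> 'e::real_normed_vector"
  assumes "conforming_mesh \<Omega> \<T>" "v \<in> mesh_space k \<Omega> \<T>" "S \<in> subsimplices \<T>"
  shows "\<exists>p. vec_polynomial k p \<and> (\<forall>x\<in>S. v x = p x)"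
proof -
  obtain F \<tau> where S: "S = rel_interior F" and F: "\<tau> \<in> \<T>" "F face_of closure \<tau>"
    using assms(3) unfolding subsimplices_def by blast
  obtain p where p: "vec_polynomial k p" "\<forall>x\<in>\<tau>. v x = p x"
    using assms(2) F(1) unfolding mesh_space_def by blast
  have "closure \<tau> \<subseteq> closure \<Omega>"
    using F(1) unfolding conforming_mesh_closure[OF assms(1), symmetric] by blast
  then have "continuous_on (closure \<tau>) (\<lambda>x. v x - p x)"
    using assms(2) continuous_on_subset unfolding mesh_space_def
    by (intro continuous_on_diff vec_polynomial_continuous[OF p(1)]) blast
  then have "v x - p x = 0" if "x \<in> closure \<tau>" for x
    using continuous_constant_on_closure[of \<tau> "\<lambda>x. v x - p x" 0 x] p(2) that by simp
  moreover have "S \<subseteq> closure \<tau>"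
    using S face_of_imp_subset[OF F(2)] rel_interior_subset by blast
  ultimately show ?thesis using p(1) by (intro exI[of _ p]) auto
qed

text \<open>
  Positivity makes the truncated power agree with the ordinary power; the upper bound is the height
  that a mask must exceed to silence a neuron.
\<close>

lemma ex_positive_lattice_forms:
  fixes B :: "(real ^ 'n) set"
  assumes "bounded B"
  shows "\<exists>\<epsilon>>0. \<forall>x\<in>B. \<forall>\<alpha>\<in>multi_indices k.
    0 < 1 + \<epsilon> * (\<Sum>i\<in>UNIV. real (\<alpha> i) * x $ i) \<and> 1 + \<epsilon> * (\<Sum>i\<in>UNIV. real (\<alpha> i) * x $ i) \<le> 2"
proof -
  obtain R where R: "R > 0" "\<And>x. x \<in> B \<Longrightarrow> norm x \<le> R"
    using assms bounded_pos by blast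
  define \<epsilon> where "\<epsilon> = 1 / (2 * (real k * R + 1))"
  have pos: "real k * R + 1 > 0" using R(1) by (simp add: add_nonneg_pos)
  have "\<bar>\<epsilon> * (\<Sum>i\<in>UNIV. real (\<alpha> i) * x $ i)\<bar> \<le> 1 / 2" if "x \<in> B" "\<alpha> \<in> multi_indices k" for x \<alpha>
  proof -
    have "\<bar>\<Sum>i\<in>UNIV. real (\<alpha> i) * x $ i\<bar> \<le> (\<Sum>i\<in>UNIV. real (\<alpha> i) * R)"
    proof (rule order_trans[OF sum_abs sum_mono])
      fix i
      show "\<bar>real (\<alpha> i) * x $ i\<bar> \<le> real (\<alpha> i) * R"
        using component_le_norm_cart[of x i] R(2)[OF that(1)]
        by (simp add: abs_mult mult_left_mono)
    qed
    also have "\<dots> = real (\<Sum>i\<in>UNIV. \<alpha> i) * R" by (simp add: sum_distrib_right)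
    also have "\<dots> \<le> real k * R"
      using that(2) R(1) unfolding multi_indices_def mem_Collect_eq
      by (intro mult_right_mono) (simp_all only: of_nat_le_iff less_imp_le)
    finally have "\<bar>\<Sum>i\<in>UNIV. real (\<alpha> i) * x $ i\<bar> \<le> real k * R + 1" by simp
    then show ?thesis using pos by (simp add: \<epsilon>_def abs_mult field_simps)
  qed
  moreover have "\<epsilon> > 0" using pos by (simp add: \<epsilon>_def)
  ultimately show ?thesis by (intro exI[of _ \<epsilon>]) (fastforce simp: abs_le_iff)
qed

lemma activation_pos: "0 < t \<Longrightarrow> activation k t = t ^ k"
  and activation_nonpos: "t \<le> 0 \<Longrightarrow> activation k t = 0"
  by (auto simp: activation_def)

lemma ex_coordinates:
  fixes b :: "'m::finite \<Rightarrow> 'e::real_vector"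
  assumes "inj b" "span (range b) = UNIV"
  shows "\<exists>t. e = (\<Sum>l\<in>UNIV. t l *\<^sub>R b l)"
proof -
  have "e \<in> range (\<lambda>u. \<Sum>v\<in>range b. u v *\<^sub>R v)"
    using assms(2) span_finite[of "range b"] by simp
  then obtain u where "e = (\<Sum>v\<in>range b. u v *\<^sub>R v)" by blast
  then show ?thesis by (intro exI[of _ "u \<circ> b"]) (simp add: sum.reindex[OF assms(1)])
qed

text \<open>
  The second hidden layer has one neuron for each subsimplex $S$ and each lattice form $\ell_\alpha$,
  with input $\ell_\alpha - 2 m_S$, where $m_S$ is the mask of $S$. On the closure of the domain its
  output is $\ell_\alpha^k$ on $S$ and $0$ elsewhere. As the subsimplices partition the closure, the
  output layer can expand the polynomial of each $S$ in the powers $\ell_\alpha^k$ independently.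
\<close>

lemma mesh_space_realized:
  fixes \<Omega> :: "(real ^ 'd) set" and b :: "'m::finite \<Rightarrow> 'e::real_normed_vector"
  assumes bounded: "bounded \<Omega>" and mesh: "conforming_mesh \<Omega> \<T>"
    and b: "inj b" "span (range b) = UNIV" and v: "v \<in> mesh_space k \<Omega> \<T>"
  shows "\<exists>f \<in> NN k (2 * card (facet_hyperplanes \<T>))
        (((CARD('d) + k) choose CARD('d)) * card (subsimplices \<T>)).
      \<forall>x \<in> closure \<Omega>. v x = (\<Sum>l\<in>UNIV. (f x :: real ^ 'm) $ l *\<^sub>R b l)"
proof -
  define H where "H = facet_hyperplanes \<T>"
  define MI :: "('d \<Rightarrow> nat) set" where "MI = multi_indices k"
  note finT = conforming_mesh_finite[OF mesh] and simplices = conforming_mesh_open_simplex[OF mesh]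
  have finH: "finite H" unfolding H_def by (rule finite_facet_hyperplanes[OF finT simplices])
  have finS: "finite (subsimplices \<T>)" using card_subsimplices_le[OF finT simplices] by blast
  have "\<forall>h\<in>H. \<exists>a b. h = {x. a \<bullet> x + b = 0}"
    by (intro ballI facet_hyperplanes_equation[OF simplices]) (simp_all add: H_def)
  from bchoice[OF this] obtain n where "\<forall>h\<in>H. \<exists>b. h = {x. n h \<bullet> x + b = 0}" by (rule exE)
  from bchoice[OF this] obtain c where "\<forall>h\<in>H. h = {x. n h \<bullet> x + c h = 0}" by (rule exE)
  then have eqn: "h = {x. n h \<bullet> x + c h = 0}" if "h \<in> H" for h
    using that by (rule bspec)
  obtain \<epsilon> where \<epsilon>: "\<epsilon> > 0" and forms: "\<And>x \<alpha>. x \<in> closure \<Omega> \<Longrightarrow> \<alpha> \<in> MI \<Longrightarrow>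
      0 < 1 + \<epsilon> * (\<Sum>i\<in>UNIV. real (\<alpha> i) * x $ i) \<and> 1 + \<epsilon> * (\<Sum>i\<in>UNIV. real (\<alpha> i) * x $ i) \<le> 2"
    using ex_positive_lattice_forms[OF bounded_closure[OF bounded], of k] unfolding MI_def by blast
  define ell where "ell \<alpha> x = 1 + \<epsilon> * (\<Sum>i\<in>UNIV. real (\<alpha> i) * x $ i)" for \<alpha> :: "'d \<Rightarrow> nat" and x :: "real ^ 'd"
  have ell_affine: "ell \<alpha> x = (\<epsilon> *\<^sub>R (\<chi> i. real (\<alpha> i))) \<bullet> x + 1" for \<alpha> x
    by (simp add: ell_def inner_vec_def sum_distrib_left mult.assoc)
  \<comment> \<open>A single element with \<open>S\<close> among its faces supplies both the mask and all affine forms.\<close>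
  have gates: "(\<exists>m\<in>two_sided n c H. \<forall>x. (x \<in> S \<longrightarrow> m x = 0) \<and> (x \<notin> S \<longrightarrow> m x \<ge> 1))
      \<and> ell \<alpha> \<in> two_sided n c H" if S: "S \<in> subsimplices \<T>" for S \<alpha>
  proof -
    obtain \<tau> V W where \<tau>: "\<tau> \<in> \<T>" and V: "\<not> affine_dependent V" "card V = Suc DIM(real ^ 'd)"
        "closure \<tau> = convex hull V" and W: "W \<subseteq> V" "S = rel_interior (convex hull W)"
      using subsimplices_simplex[OF simplices S] by blast
    have facets: "affine hull (V - {w}) \<in> H" if "w \<in> V" for w
      unfolding H_def by (rule facet_hyperplanes_simplex[OF \<tau> V that])
    have "ell \<alpha> \<in> two_sided n c H"
      using two_sided_all_affine[OF V(1,2) finH facets eqn] unfolding ell_affine[abs_def] by blast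
    then show ?thesis
      using two_sided_face_mask[OF V(1,2) finH facets eqn W(1)] unfolding W(2) by blast
  qed
  have "\<forall>S\<in>subsimplices \<T>. \<exists>m. m \<in> two_sided n c H
      \<and> (\<forall>x. (x \<in> S \<longrightarrow> m x = 0) \<and> (x \<notin> S \<longrightarrow> m x \<ge> 1))"
    using gates by (simp add: Bex_def)
  from bchoice[OF this] obtain mask where "\<forall>S\<in>subsimplices \<T>. mask S \<in> two_sided n c H
      \<and> (\<forall>x. (x \<in> S \<longrightarrow> mask S x = 0) \<and> (x \<notin> S \<longrightarrow> mask S x \<ge> 1))" by (rule exE)
  then have mask: "\<And>S. S \<in> subsimplices \<T> \<Longrightarrow> mask S \<in> two_sided n c H"
    and mask0: "\<And>S x. S \<in> subsimplices \<T> \<Longrightarrow> x \<in> S \<Longrightarrow> mask S x = 0"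
    and mask1: "\<And>S x. S \<in> subsimplices \<T> \<Longrightarrow> x \<notin> S \<Longrightarrow> mask S x \<ge> 1"
    by simp_all
  have "\<exists>K. \<forall>x. (\<Prod>i\<in>UNIV. (x $ i) ^ \<gamma> i) = (\<Sum>\<alpha>\<in>MI. K \<alpha> * ell \<alpha> x ^ k)" if "\<gamma> \<in> MI" for \<gamma>
    using monomial_in_span_affine_powers[of \<epsilon> \<gamma> k] \<epsilon> that unfolding MI_def ell_def by simp
  then have "\<forall>\<gamma>\<in>MI. \<exists>K. \<forall>x. (\<Prod>i\<in>UNIV. (x $ i) ^ \<gamma> i) = (\<Sum>\<alpha>\<in>MI. K \<alpha> * ell \<alpha> x ^ k)"
    by (rule ballI)
  from bchoice[OF this] obtain K where "\<forall>\<gamma>\<in>MI. \<forall>x.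
      (\<Prod>i\<in>UNIV. (x $ i) ^ \<gamma> i) = (\<Sum>\<alpha>\<in>MI. K \<gamma> \<alpha> * ell \<alpha> x ^ k)" by (rule exE)
  then have K: "\<And>\<gamma> x. \<gamma> \<in> MI \<Longrightarrow>
      (\<Prod>i\<in>UNIV. (x $ i) ^ \<gamma> i) = (\<Sum>\<alpha>\<in>MI. K \<gamma> \<alpha> * ell \<alpha> x ^ k)"
    by blast
  have "\<exists>cf. \<forall>x\<in>S. v x = (\<Sum>\<gamma>\<in>MI. (\<Prod>i\<in>UNIV. (x $ i) ^ \<gamma> i) *\<^sub>R cf \<gamma>)"
    if S: "S \<in> subsimplices \<T>" for S
  proof -
    obtain p cf where "\<forall>x\<in>S. v x = p x"
        and "\<forall>x. p x = (\<Sum>\<gamma>\<in>MI. (\<Prod>i\<in>UNIV. (x $ i) ^ \<gamma> i) *\<^sub>R cf \<gamma>)"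
      using mesh_space_polynomial_on_subsimplex[OF mesh v S] unfolding vec_polynomial_def MI_def
      by blast
    then show ?thesis by (intro exI[of _ cf]) simp
  qed
  then have "\<forall>S\<in>subsimplices \<T>. \<exists>cf. \<forall>x\<in>S. v x = (\<Sum>\<gamma>\<in>MI. (\<Prod>i\<in>UNIV. (x $ i) ^ \<gamma> i) *\<^sub>R cf \<gamma>)"
    by (rule ballI)
  from bchoice[OF this] obtain cf where "\<forall>S\<in>subsimplices \<T>. \<forall>x\<in>S.
      v x = (\<Sum>\<gamma>\<in>MI. (\<Prod>i\<in>UNIV. (x $ i) ^ \<gamma> i) *\<^sub>R cf S \<gamma>)" by (rule exE)
  then have cf: "\<And>S x. S \<in> subsimplices \<T> \<Longrightarrow> x \<in> S \<Longrightarrow>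
      v x = (\<Sum>\<gamma>\<in>MI. (\<Prod>i\<in>UNIV. (x $ i) ^ \<gamma> i) *\<^sub>R cf S \<gamma>)"
    by blast
  \<comment> \<open>The coefficient of the power \<open>ell \<alpha> x ^ k\<close> in the polynomial of \<open>S\<close>, for \<open>q = (S, \<alpha>)\<close>.\<close>
  define d where "d q = (\<Sum>\<gamma>\<in>MI. K \<gamma> (snd q) *\<^sub>R cf (fst q) \<gamma>)" for q
  obtain w where "\<forall>q. d q = (\<Sum>l\<in>UNIV. w q l *\<^sub>R b l)"
    using choice[OF allI[OF ex_coordinates[OF b, of "d _"]]] by (rule exE)
  then have w: "d q = (\<Sum>l\<in>UNIV. w q l *\<^sub>R b l)" for q by (rule spec)
  define g where "g q x = ell (snd q) x - 2 * mask (fst q) x" for q x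
  define Q where "Q = subsimplices \<T> \<times> MI"
  define f :: "real ^ 'd \<Rightarrow> real ^ 'm" where "f x = (\<chi> l. \<Sum>q\<in>Q. w q l * activation k (g q x))" for x
  have g: "g q \<in> two_sided n c H" if "q \<in> Q" for q
    using that mask gates unfolding g_def[abs_def] Q_def
    by (intro preactivations_diff preactivations_scale) auto
  have "f \<in> NN k (card (H \<times> (UNIV :: bool set))) (card Q)"
    by (rule NN_finite_indexI[OF _ _ g]) (auto simp: f_def Q_def finS finH MI_def)
  moreover have "card (H \<times> (UNIV :: bool set)) = 2 * card (facet_hyperplanes \<T>)"
    by (simp add: card_cartesian_product H_def)
  moreover have "card Q = ((CARD('d) + k) choose CARD('d)) * card (subsimplices \<T>)"
    by (simp add: Q_def MI_def card_cartesian_product card_multi_indices)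
  moreover have "v x = (\<Sum>l\<in>UNIV. f x $ l *\<^sub>R b l)" if x: "x \<in> closure \<Omega>" for x
  proof -
    obtain S where S: "S \<in> subsimplices \<T>" "x \<in> S"
      using x subsimplices_cover simplices unfolding conforming_mesh_closure[OF mesh, symmetric] by blast
    have on: "activation k (g (S, \<alpha>) x) = ell \<alpha> x ^ k" if "\<alpha> \<in> MI" for \<alpha>
      using forms[OF x that] mask0[OF S] by (simp add: g_def ell_def activation_pos)
    have off: "activation k (g (S', \<alpha>) x) = 0" 
      if "\<alpha> \<in> MI" "S' \<in> subsimplices \<T> - {S}" for \<alpha> S'
    proof -
      have "x \<notin> S'" using subsimplices_disjoint[OF mesh S(1) _ S(2)] that(2) by blast
      then have "mask S' x \<ge> 1" using mask1 that(2) by blast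
      then have "g (S', \<alpha>) x \<le> 0" using forms[OF x that(1)] by (simp add: g_def ell_def)
      then show ?thesis by (rule activation_nonpos)
    qed
    have "(\<Sum>l\<in>UNIV. f x $ l *\<^sub>R b l) = (\<Sum>l\<in>UNIV. \<Sum>q\<in>Q. activation k (g q x) *\<^sub>R w q l *\<^sub>R b l)"
      by (simp add: f_def scaleR_left.sum mult.commute)
    also have "\<dots> = (\<Sum>q\<in>Q. activation k (g q x) *\<^sub>R d q)"
      by (subst sum.swap) (simp add: w scaleR_right.sum)
    also have "\<dots> = (\<Sum>S'\<in>subsimplices \<T>. \<Sum>\<alpha>\<in>MI. activation k (g (S', \<alpha>) x) *\<^sub>R d (S', \<alpha>))"
      by (simp add: Q_def sum.cartesian_product)
    also have "\<dots> = (\<Sum>\<alpha>\<in>MI. activation k (g (S, \<alpha>) x) *\<^sub>R d (S, \<alpha>))"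
      by (subst sum.remove[OF finS S(1)]) (simp add: off)
    also have "\<dots> = (\<Sum>\<alpha>\<in>MI. \<Sum>\<gamma>\<in>MI. (K \<gamma> \<alpha> * ell \<alpha> x ^ k) *\<^sub>R cf S \<gamma>)"
      by (simp add: on d_def scaleR_right.sum mult.commute)
    also have "\<dots> = (\<Sum>\<gamma>\<in>MI. (\<Prod>i\<in>UNIV. (x $ i) ^ \<gamma> i) *\<^sub>R cf S \<gamma>)"
      by (subst sum.swap) (simp add: K scaleR_left.sum)
    finally show ?thesis using cf[OF S] by simp
  qed
  ultimately show ?thesis by metis
qed

theorem corollary9:
  fixes \<Omega> :: "(real ^ 'd) set"
    and \<T> :: "(real ^ 'd) set set"
    and b :: "'m::finite \<Rightarrow> 'e::real_normed_vector"
    and k M :: nat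
  assumes "open_polyhedral \<Omega>"
    and "conforming_mesh \<Omega> \<T>"
    and "inj b" and "independent (range b)" and "span (range b) = UNIV"
    and "M = (CARD('d) + k) choose CARD('d)"
  shows "(\<forall>v \<in> mesh_space k \<Omega> \<T>.
            \<exists>f \<in> NN k (2 * card (facet_hyperplanes \<T>)) (M * card (subsimplices \<T>)).
              \<forall>x \<in> closure \<Omega>. v x = (\<Sum>l\<in>UNIV. (f x :: real ^ 'm) $ l *\<^sub>R b l))
         \<and> M * card (subsimplices \<T>) \<le> M * (2 ^ (CARD('d) + 1) - 1) * card \<T>"
proof
  have "bounded \<Omega>" using assms(1) by (simp add: open_polyhedral_def)
  then show "\<forall>v \<in> mesh_space k \<Omega> \<T>.
      \<exists>f \<in> NN k (2 * card (facet_hyperplanes \<T>)) (M * card (subsimplices \<T>)).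
        \<forall>x \<in> closure \<Omega>. v x = (\<Sum>l\<in>UNIV. (f x :: real ^ 'm) $ l *\<^sub>R b l)"
    unfolding assms(6) using mesh_space_realized[OF _ assms(2,3,5)] by blast
  have "card (subsimplices \<T>) \<le> (2 ^ Suc DIM(real ^ 'd) - 1) * card \<T>"
    using card_subsimplices_le[OF conforming_mesh_finite[OF assms(2)] conforming_mesh_open_simplex[OF assms(2)]]
    by blast
  then show "M * card (subsimplices \<T>) \<le> M * (2 ^ (CARD('d) + 1) - 1) * card \<T>"
    by (simp add: mult.assoc)
qed

end
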